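(* Let $p > 0$, let $M_t \in \mathbb{R}^{m \times n}$ be the exponential moving average of the gradients with reduced singular value decomposition $M_t = U_t \Sigma_t V_t^\top$, and let $L_t \in \mathbb{R}^{m \times m}$ and $R_t \in \mathbb{R}^{n \times n}$ be the Shampoo factor matrices, assumed to be invertible (hence symmetric positive definite). Then the Shampoo update direction decomposes as $$L_t^{-p} M_t R_t^{-p} = \Big( L_t^{-p} \left(M_t M_t^\top\right)^{\frac14} \Big)\, U_t V_t^\top \,\Big( \left(M_t^\top M_t\right)^{\frac14} R_t^{-p} \Big).$$
   Context: Given gradient matrices $G_1, G_2, \dots \in \mathbb{R}^{m\times n}$ and $\beta_1,\beta_2 \in [0,1)$, define recursively, starting from $M_0 = 0$, $L_0 = 0$, $R_0 = 0$: $M_t = \beta_1 M_{t-1} + (1-\beta_1) G_t$, $L_t = \beta_2 L_{t-1} + (1-\beta_2) G_t G_t^\top$, and $R_t = \beta_2 R_{t-1} + (1-\beta_2) G_t^\top G_t$. The reduced SVD of a matrix of rank $k$ is $U\Sigma V^\top$ with $U \in \mathbb{R}^{m\times k}$, $V \in \mathbb{R}^{n\times k}$ having orthonormal columns and $\Sigma\in\mathbb{R}^{k\times k}$ diagonal with positive entries. For a symmetric positive semi-definite matrix $X$, $X^{1/4}$ denotes its unique symmetric positive semi-definite fourth root; for a symmetric positive definite $X$, $X^{-p}$ is defined through the spectral decomposition. (The factor $U_tV_t^\top$ is the Muon update direction.) *)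

theory Defs
  imports "Jordan_Normal_Form.DL_Rank" Complex_Main
begin

text \<open>Matrices are those of \<^theory>\<open>Jordan_Normal_Form.Matrix\<close>, whose dimensions are natural
  numbers; in particular the rank in a reduced SVD may be any number, including 0.\<close>

primrec ema :: "nat \<Rightarrow> nat \<Rightarrow> real \<Rightarrow> (nat \<Rightarrow> real mat) \<Rightarrow> nat \<Rightarrow> real mat" where
  "ema r c \<beta> X 0 = 0\<^sub>m r c"
| "ema r c \<beta> X (Suc t) = \<beta> \<cdot>\<^sub>m ema r c \<beta> X t + (1 - \<beta>) \<cdot>\<^sub>m X (Suc t)"

definition momentum :: "nat \<Rightarrow> nat \<Rightarrow> real \<Rightarrow> (nat \<Rightarrow> real mat) \<Rightarrow> nat \<Rightarrow> real mat" where
  "momentum m n \<beta> G = ema m n \<beta> G"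

definition shampoo_L :: "nat \<Rightarrow> real \<Rightarrow> (nat \<Rightarrow> real mat) \<Rightarrow> nat \<Rightarrow> real mat" where
  "shampoo_L m \<beta> G = ema m m \<beta> (\<lambda>s. G s * transpose_mat (G s))"

definition shampoo_R :: "nat \<Rightarrow> real \<Rightarrow> (nat \<Rightarrow> real mat) \<Rightarrow> nat \<Rightarrow> real mat" where
  "shampoo_R n \<beta> G = ema n n \<beta> (\<lambda>s. transpose_mat (G s) * G s)"

definition reduced_svd :: "real mat \<Rightarrow> real mat \<Rightarrow> real mat \<Rightarrow> real mat \<Rightarrow> bool" where
  "reduced_svd M U S V \<longleftrightarrow>
    (let m = dim_row M; n = dim_col M; k = vec_space.rank m M in
      U \<in> carrier_mat m k \<and> S \<in> carrier_mat k k \<and> V \<in> carrier_mat n k \<and>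
      transpose_mat U * U = 1\<^sub>m k \<and> transpose_mat V * V = 1\<^sub>m k \<and>
      diagonal_mat S \<and> (\<forall>i<k. 0 < S $$ (i, i)) \<and>
      M = U * S * transpose_mat V)"

definition psd_mat :: "real mat \<Rightarrow> bool" where
  "psd_mat A \<longleftrightarrow> square_mat A \<and> transpose_mat A = A \<and>
    (\<forall>v \<in> carrier_vec (dim_row A). 0 \<le> v \<bullet> (A *\<^sub>v v))"

definition psd_root :: "nat \<Rightarrow> real mat \<Rightarrow> real mat" where
  "psd_root k X = (THE Y. psd_mat Y \<and> Y ^\<^sub>m k = X)"

text \<open>Real powers through a spectral decomposition: the result does not depend on the
  orthogonal diagonalization chosen. Meaningful for symmetric positive definite matrices,
  whose eigenvalues \<^term>\<open>d i\<close> are positive.\<close>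

definition spectral_powr :: "real mat \<Rightarrow> real \<Rightarrow> real mat" where
  "spectral_powr X a = (THE Y. \<exists>Q d. let n = dim_row X in
      Q \<in> carrier_mat n n \<and> transpose_mat Q * Q = 1\<^sub>m n \<and>
      X = Q * mat_diag n d * transpose_mat Q \<and>
      Y = Q * mat_diag n (\<lambda>i. d i powr a) * transpose_mat Q)"

end

theory Submission
  imports Defs "Jordan_Normal_Form.Spectral_Radius"
begin

text \<open>Writing \<open>M = U S V\<^sup>T\<close>, the two fourth roots are \<open>U S\<^bsup>1/2\<^esup> U\<^sup>T\<close> and
  \<open>V S\<^bsup>1/2\<^esup> V\<^sup>T\<close>, so multiplying \<open>U V\<^sup>T\<close> by them from the left and the right gives back
  \<open>M\<close>; associativity does the rest. The spectral theorem enters twice: it makes positive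
  semi-definite roots unique, and it makes the definite descriptions behind the powers of \<open>L\<close>
  and \<open>R\<close> denote matrices of the right size.\<close>

section \<open>Products \<open>U * D * V\<^sup>T\<close> with a diagonal middle factor\<close>

text \<open>Dimension equations as premises, rather than carrier sets with free dimension
  parameters, let the simplifier use associativity as a rewrite rule.\<close>

lemma mult_mat_assoc:
  fixes A B C :: "'a::semiring_0 mat"
  assumes "dim_col A = dim_row B" "dim_col B = dim_row C"
  shows "A * B * C = A * (B * C)"
  by (rule assoc_mult_mat[of A "dim_row A" "dim_col A" B "dim_col B" C "dim_col C"])
    (use assms in auto)

lemma transpose_mult_mat:
  fixes A B :: "'a::comm_semiring_0 mat"
  assumes "dim_col A = dim_row B"
  shows "(A * B)\<^sup>T = B\<^sup>T * A\<^sup>T"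
  by (rule transpose_mult[of A "dim_row A" "dim_col A" B "dim_col B"]) (use assms in auto)

lemma mat_diag_simps [simp]:
  "dim_row (mat_diag n d) = n" "dim_col (mat_diag n d) = n"
  "(mat_diag n d)\<^sup>T = mat_diag n d"
  by (auto simp: mat_diag_def)

text \<open>The inner factor \<open>V\<^sup>T * V\<close> collapses and leaves a product of diagonal
  matrices. Rectangular factors are allowed, so the rule serves reduced decompositions and
  orthogonal diagonalizations alike.\<close>

lemma sandwich_mult:
  fixes U V W :: "'a::comm_semiring_1 mat"
  assumes U: "U \<in> carrier_mat m k" and V: "V \<in> carrier_mat n k" and W: "W \<in> carrier_mat l k"
    and VV: "V\<^sup>T * V = 1\<^sub>m k"
  shows "(U * mat_diag k d * V\<^sup>T) * (V * mat_diag k e * W\<^sup>T) = U * mat_diag k (\<lambda>i. d i * e i) * W\<^sup>T"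
proof -
  let ?D = "mat_diag k d" and ?E = "mat_diag k e"
  have "(U * ?D * V\<^sup>T) * (V * ?E * W\<^sup>T) = U * ?D * (V\<^sup>T * V) * (?E * W\<^sup>T)"
    using U V W by (simp add: mult_mat_assoc)
  also have "\<dots> = U * (?D * ?E) * W\<^sup>T"
    using U W unfolding VV by (simp add: mult_mat_assoc del: mat_diag_diag)
  finally show ?thesis by simp
qed

text \<open>Exponents start at 1: for \<open>k < m\<close> the zeroth power is the identity, whereas
  \<open>U * U\<^sup>T\<close> is only a projection of rank \<open>k\<close>.\<close>

lemma sandwich_pow:
  fixes U :: "'a::comm_semiring_1 mat"
  assumes U: "U \<in> carrier_mat m k" and UU: "U\<^sup>T * U = 1\<^sub>m k"
  shows "(U * mat_diag k d * U\<^sup>T) ^\<^sub>m Suc j = U * mat_diag k (\<lambda>i. d i ^ Suc j) * U\<^sup>T"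
proof (induction j)
  case 0
  have "U * mat_diag k d * U\<^sup>T \<in> carrier_mat m m" using U by auto
  then show ?case by simp
next
  case (Suc j)
  have "(U * mat_diag k d * U\<^sup>T) ^\<^sub>m Suc (Suc j)
      = (U * mat_diag k (\<lambda>i. d i ^ Suc j) * U\<^sup>T) * (U * mat_diag k d * U\<^sup>T)"
    using Suc by simp
  also have "\<dots> = U * mat_diag k (\<lambda>i. d i ^ Suc (Suc j)) * U\<^sup>T"
    by (simp add: sandwich_mult[OF U U U UU] mult.commute)
  finally show ?case .
qed

lemma transpose_sandwich:
  fixes U V :: "'a::comm_semiring_1 mat"
  assumes U: "U \<in> carrier_mat m k" and V: "V \<in> carrier_mat n k"
  shows "(U * mat_diag k d * V\<^sup>T)\<^sup>T = V * mat_diag k d * U\<^sup>T"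
  using U V by (simp add: transpose_mult_mat mult_mat_assoc)

section \<open>Quadratic forms and change of diagonalization\<close>

text \<open>Moving \<open>U\<close> across the scalar product turns the form into a diagonal one in
  the coordinates \<open>U\<^sup>T *\<^sub>v v\<close>.\<close>

lemma quadratic_form_sandwich:
  fixes U :: "real mat"
  assumes U: "U \<in> carrier_mat n k" and v: "v \<in> carrier_vec n"
  shows "v \<bullet> ((U * mat_diag k d * U\<^sup>T) *\<^sub>v v) = (\<Sum>i<k. d i * ((U\<^sup>T *\<^sub>v v) $ i)\<^sup>2)"
proof -
  let ?w = "U\<^sup>T *\<^sub>v v"
  have w: "?w \<in> carrier_vec k" using U v by auto
  have Dw: "mat_diag k d *\<^sub>v ?w = vec k (\<lambda>i. d i * ?w $ i)"
  proof (rule eq_vecI)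
    fix i assume "i < dim_vec (vec k (\<lambda>i. d i * ?w $ i))"
    hence i: "i < k" by simp
    have "(mat_diag k d *\<^sub>v ?w) $ i = (\<Sum>j = 0..<k. (if i = j then d j else 0) * ?w $ j)"
      using i U by (simp add: mat_diag_def scalar_prod_def)
    also have "\<dots> = (\<Sum>j = 0..<k. if i = j then d j * ?w $ j else 0)"
      by (rule sum.cong) auto
    also have "\<dots> = d i * ?w $ i" using i by simp
    finally show "(mat_diag k d *\<^sub>v ?w) $ i = vec k (\<lambda>i. d i * ?w $ i) $ i" using i by simp
  qed (simp add: mat_diag_def)
  have "(U * mat_diag k d * U\<^sup>T) *\<^sub>v v = U *\<^sub>v (mat_diag k d *\<^sub>v ?w)"
    using U v by (simp add: assoc_mult_mat_vec[of _ n k _ n] assoc_mult_mat_vec[of _ n k _ k])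
  hence "v \<bullet> ((U * mat_diag k d * U\<^sup>T) *\<^sub>v v) = ?w \<bullet> (mat_diag k d *\<^sub>v ?w)"
    using U v w by (metis mat_diag_dim mult_mat_vec_carrier transpose_vec_mult_scalar comm_scalar_prod
        transpose_carrier_mat)
  also have "\<dots> = (\<Sum>i<k. d i * (?w $ i)\<^sup>2)"
    unfolding Dw by (simp add: scalar_prod_def power2_eq_square lessThan_atLeast0 algebra_simps)
  finally show ?thesis .
qed

lemma psd_mat_sandwich:
  assumes U: "U \<in> carrier_mat n k" and d: "\<And>i. i < k \<Longrightarrow> 0 \<le> d i"
  shows "psd_mat (U * mat_diag k d * U\<^sup>T)"
  unfolding psd_mat_def
proof (intro conjI ballI)
  show "square_mat (U * mat_diag k d * U\<^sup>T)" using U by auto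
  show "(U * mat_diag k d * U\<^sup>T)\<^sup>T = U * mat_diag k d * U\<^sup>T"
    by (rule transpose_sandwich[OF U U])
  fix v :: "real vec" assume "v \<in> carrier_vec (dim_row (U * mat_diag k d * U\<^sup>T))"
  hence v: "v \<in> carrier_vec n" using U by simp
  show "0 \<le> v \<bullet> ((U * mat_diag k d * U\<^sup>T) *\<^sub>v v)"
    unfolding quadratic_form_sandwich[OF U v] using d by (intro sum_nonneg) auto
qed

text \<open>With \<open>W = P\<^sup>T Q\<close>, equality of the two diagonalizations reads
  \<open>W\<^sub>i\<^sub>j d\<^sub>j = e\<^sub>i W\<^sub>i\<^sub>j\<close>, so \<open>d\<^sub>j = e\<^sub>i\<close> wherever \<open>W\<^sub>i\<^sub>j \<noteq> 0\<close>.\<close>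

lemma diagonalization_independence:
  fixes P Q :: "'a::field mat"
  assumes Q: "Q \<in> carrier_mat n n" "Q\<^sup>T * Q = 1\<^sub>m n"
    and P: "P \<in> carrier_mat n n" "P\<^sup>T * P = 1\<^sub>m n"
    and eq: "Q * mat_diag n d * Q\<^sup>T = P * mat_diag n e * P\<^sup>T"
    and fg: "\<And>i j. i < n \<Longrightarrow> j < n \<Longrightarrow> d j = e i \<Longrightarrow> d' j = e' i"
  shows "Q * mat_diag n d' * Q\<^sup>T = P * mat_diag n e' * P\<^sup>T"
proof -
  have QQ: "Q * Q\<^sup>T = 1\<^sub>m n" and PP: "P * P\<^sup>T = 1\<^sub>m n"
    using P Q by (auto intro: mat_mult_left_right_inverse[of _ n])
  \<comment> \<open>Stated with a trailing factor \<open>X\<close>, the shape that arises once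
    products are bracketed to the right.\<close>
  have cancel: "P\<^sup>T * (P * X) = X" "P * (P\<^sup>T * X) = X" if "dim_row X = n" for X
    using that P PP mult_mat_assoc[of "P\<^sup>T" P X] mult_mat_assoc[of P "P\<^sup>T" X]
      left_mult_one_mat[OF carrier_matI[OF that refl]] by simp_all
  define W where "W = P\<^sup>T * Q"
  have W: "W \<in> carrier_mat n n" unfolding W_def using P Q by auto
  have "P\<^sup>T * (Q * mat_diag n d * Q\<^sup>T) * Q = P\<^sup>T * (P * mat_diag n e * P\<^sup>T) * Q"
    by (simp only: eq)
  hence "W * mat_diag n d = mat_diag n e * W"
    unfolding W_def using P Q by (simp add: cancel mult_mat_assoc)
  hence entry: "W $$ (i,j) * d j = e i * W $$ (i,j)" if "i < n" "j < n" for i j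
    using that W unfolding mat_diag_mult_left[OF W] mat_diag_mult_right[OF W]
    by (auto dest!: arg_cong[of _ _ "\<lambda>X. X $$ (i,j)"])
  have WW: "W * mat_diag n d' = mat_diag n e' * W"
    unfolding mat_diag_mult_left[OF W] mat_diag_mult_right[OF W]
  proof (rule eq_matI)
    fix i j assume "i < dim_row (Matrix.mat n n (\<lambda>(i, j). e' i * W $$ (i, j)))"
      "j < dim_col (Matrix.mat n n (\<lambda>(i, j). e' i * W $$ (i, j)))"
    hence ij: "i < n" "j < n" by auto
    show "Matrix.mat n n (\<lambda>(i, j). W $$ (i, j) * d' j) $$ (i, j)
        = Matrix.mat n n (\<lambda>(i, j). e' i * W $$ (i, j)) $$ (i, j)"
      using ij entry[OF ij] fg[OF ij] by (cases "W $$ (i,j) = 0") auto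
  qed auto
  \<comment> \<open>As \<open>P * W = Q\<close>, the left side is the first diagonalization; on the
    right \<open>Q * Q\<^sup>T\<close> cancels and leaves the second.\<close>
  have "P * (W * mat_diag n d') * Q\<^sup>T = P * (mat_diag n e' * W) * Q\<^sup>T"
    by (simp only: WW)
  thus ?thesis
    unfolding W_def using P Q QQ by (simp add: cancel mult_mat_assoc)
qed

section \<open>The spectral theorem for real symmetric matrices\<close>

text \<open>A complex eigenvalue exists since \<open>n > 0\<close>. The Hermitian form at its
  eigenvector is real and equals the eigenvalue times the squared norm, so the eigenvalue is
  real.\<close>

lemma symmetric_mat_real_eigenvalue:
  fixes A :: "real mat"
  assumes A: "A \<in> carrier_mat n n" and sym: "A\<^sup>T = A" and n: "n > 0"
  shows "\<exists>e. eigenvalue A e"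
proof -
  let ?C = "map_mat complex_of_real A"
  have C: "?C \<in> carrier_mat n n" using A by auto
  obtain z where z: "eigenvalue ?C z"
    using spectrum_non_empty[OF C n] unfolding spectrum_def by auto
  then obtain v where v: "v \<in> carrier_vec n" "v \<noteq> 0\<^sub>v n" "?C *\<^sub>v v = z \<cdot>\<^sub>v v"
    using A unfolding eigenvalue_def eigenvector_def by auto
  have Aij: "A $$ (i,j) = A $$ (j,i)" if "i < n" "j < n" for i j
    using that A sym by (metis index_transpose_mat(1) carrier_matD)
  have Cv: "(\<Sum>j<n. complex_of_real (A $$ (i,j)) * v $ j) = z * v $ i" if "i < n" for i
    using arg_cong[OF v(3), of "\<lambda>w. w $ i"] that A v(1)
    by (simp add: scalar_prod_def lessThan_atLeast0)
  \<comment> \<open>\<open>a\<close> is the Hermitian form of \<open>A\<close> at \<open>v\<close>,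
    and \<open>s\<close> is the squared norm of \<open>v\<close>.\<close>
  define a where "a = (\<Sum>i<n. cnj (v $ i) * (\<Sum>j<n. complex_of_real (A $$ (i,j)) * v $ j))"
  define s where "s = (\<Sum>i<n. (cmod (v $ i))\<^sup>2)"
  have "cnj (v $ i) * (z * v $ i) = z * of_real ((cmod (v $ i))\<^sup>2)" for i
    unfolding complex_norm_square by simp
  hence "a = (\<Sum>i<n. z * of_real ((cmod (v $ i))\<^sup>2))"
    unfolding a_def by (intro sum.cong) (simp_all only: Cv lessThan_iff)
  hence a_eq: "a = z * of_real s" unfolding s_def by (simp add: sum_distrib_left)
  \<comment> \<open>Conjugation, exchange of the two sums and symmetry of \<open>A\<close> give
    \<open>a\<close> back.\<close>
  have "cnj a = (\<Sum>i<n. \<Sum>j<n. v $ i * of_real (A $$ (i,j)) * cnj (v $ j))"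
    unfolding a_def by (simp add: sum_distrib_left mult_ac)
  also have "\<dots> = (\<Sum>j<n. \<Sum>i<n. v $ i * of_real (A $$ (i,j)) * cnj (v $ j))"
    by (rule sum.swap)
  also have "\<dots> = a"
    unfolding a_def by (intro sum.cong) (auto simp: sum_distrib_left mult_ac Aij intro!: sum.cong)
  finally have "cnj z * of_real s = z * of_real s"
    using a_eq by (metis complex_cnj_complex_of_real complex_cnj_mult)
  moreover have "s \<noteq> 0"
  proof
    assume "s = 0"
    hence "\<forall>i<n. v $ i = 0" unfolding s_def by (simp add: sum_nonneg_eq_0_iff)
    with v show False by (auto intro: eq_vecI)
  qed
  ultimately have "cnj z = z" by simp
  then obtain x where x: "z = of_real x" by (metis Reals_cases Reals_cnj_iff)
  \<comment> \<open>The eigenvector is complex, but the characteristic polynomial has real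
    coefficients, and its real root is an eigenvalue of \<open>A\<close> itself.\<close>
  have "poly (char_poly ?C) z = 0" using z eigenvalue_root_char_poly[OF C] by simp
  hence "poly (char_poly A) x = 0"
    unfolding of_real_hom.char_poly_hom[OF A] x by simp
  thus ?thesis using eigenvalue_root_char_poly[OF A] by auto
qed

text \<open>Gram-Schmidt on a basis completing \<open>v\<close> keeps \<open>v\<close> in first
  place; \<open>c\<close> records the normalization.\<close>

lemma orthogonal_mat_first_col:
  fixes v :: "real vec"
  assumes v: "v \<in> carrier_vec n" and v0: "v \<noteq> 0\<^sub>v n"
  obtains P c where "P \<in> carrier_mat n n" "P\<^sup>T * P = 1\<^sub>m n" "col P 0 = c \<cdot>\<^sub>v v"
proof -
  have n: "n > 0" using v v0 by (cases n) auto
  interpret cof_vec_space n "TYPE(real)" .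
  define b where "b = basis_completion v"
  define ws where "ws = gram_schmidt n b"
  note bc = basis_completion[OF v v0, folded b_def]
  obtain vs where bv: "b = v # vs" using bc(6,7) n by (cases b) auto
  note gs = gram_schmidt_result[OF bc(2,4,5) refl, folded ws_def]
  have len: "length ws = n" using gs(4) bc(6) by simp
  have "hd ws = v" using gram_schmidt_hd[OF v, of vs, folded bv] unfolding ws_def .
  hence ws0: "ws ! 0 = v" using len n by (cases ws) auto
  have wsc: "ws ! i \<in> carrier_vec n" if "i < n" for i using that gs(3) len by auto
  \<comment> \<open>Conjugation is trivial on real vectors, so the sesquilinear orthogonality of
    Gram-Schmidt is the ordinary one.\<close>
  have conj: "conjugate w = w" for w :: "real vec" by (rule eq_vecI) auto
  have orth: "ws ! i \<bullet> ws ! j = 0 \<longleftrightarrow> i \<noteq> j" if "i < n" "j < n" for i j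
    using corthogonalD[OF gs(2), of i j] that len by (simp add: conj)
  \<comment> \<open>The vectors are orthogonal but not yet of unit length; \<open>orth\<close> with
    equal indices excludes a zero norm.\<close>
  define c where "c j = 1 / sqrt (ws ! j \<bullet> ws ! j)" for j
  define P where "P = mat_of_cols n (map (\<lambda>j. c j \<cdot>\<^sub>v ws ! j) [0..<n])"
  have P: "P \<in> carrier_mat n n" unfolding P_def by auto
  have colP: "col P j = c j \<cdot>\<^sub>v ws ! j" if "j < n" for j
    using that wsc[of j] unfolding P_def by (subst col_mat_of_cols) auto
  have "P\<^sup>T * P = 1\<^sub>m n"
  proof (rule eq_matI)
    fix i j assume "i < dim_row (1\<^sub>m n :: real mat)" "j < dim_col (1\<^sub>m n :: real mat)"
    hence ij: "i < n" "j < n" by auto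
    have "(P\<^sup>T * P) $$ (i,j) = c i * (c j * (ws ! i \<bullet> ws ! j))"
      using ij P wsc[of i] wsc[of j] by (simp add: colP)
    also have "\<dots> = (1\<^sub>m n :: real mat) $$ (i,j)"
    proof (cases "i = j")
      case True
      have "ws ! i \<bullet> ws ! i \<ge> 0" by (auto simp: scalar_prod_def intro: sum_nonneg)
      with orth[OF ij(1) ij(1)] have "ws ! i \<bullet> ws ! i > 0" by auto
      thus ?thesis using True ij unfolding c_def by simp
    next
      case False
      thus ?thesis using ij orth[OF ij] by simp
    qed
    finally show "(P\<^sup>T * P) $$ (i,j) = (1\<^sub>m n :: real mat) $$ (i,j)" .
  qed (use P in auto)
  with P show ?thesis using that[of P "c 0"] colP[OF n] ws0 by auto
qed

text \<open>Deflation: in an orthonormal basis starting with an eigenvector, the first column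
  vanishes off the diagonal, by symmetry so does the first row, and induction diagonalizes the
  remaining block.\<close>

theorem real_spectral_theorem:
  fixes A :: "real mat"
  assumes "A \<in> carrier_mat n n" and "A\<^sup>T = A"
  shows "\<exists>Q d. Q \<in> carrier_mat n n \<and> Q\<^sup>T * Q = 1\<^sub>m n \<and> A = Q * mat_diag n d * Q\<^sup>T"
  using assms
proof (induction n arbitrary: A)
  case 0
  have "A = 1\<^sub>m 0 * mat_diag 0 (\<lambda>_. 0) * (1\<^sub>m 0)\<^sup>T"
    using 0 by (intro eq_matI) auto
  then show ?case by (intro exI[of _ "1\<^sub>m 0"] exI[of _ "\<lambda>_. 0"]) auto
next
  case (Suc n A)
  let ?N = "Suc n"
  note A = Suc.prems(1)
  obtain e where "eigenvalue A e"
    using symmetric_mat_real_eigenvalue[OF Suc.prems] by auto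
  then obtain v where v: "v \<in> carrier_vec ?N" "v \<noteq> 0\<^sub>v ?N" "A *\<^sub>v v = e \<cdot>\<^sub>v v"
    using A unfolding eigenvalue_def eigenvector_def by auto
  obtain P c where P: "P \<in> carrier_mat ?N ?N" "P\<^sup>T * P = 1\<^sub>m ?N" "col P 0 = c \<cdot>\<^sub>v v"
    using orthogonal_mat_first_col[OF v(1,2)] by blast
  have PP: "P * P\<^sup>T = 1\<^sub>m ?N" using P by (auto intro: mat_mult_left_right_inverse[of _ ?N])
  define B where "B = P\<^sup>T * A * P"
  have B: "B \<in> carrier_mat ?N ?N" unfolding B_def using P A by auto
  have symB: "B\<^sup>T = B"
    unfolding B_def using P A Suc.prems(2) by (simp add: transpose_mult_mat mult_mat_assoc)
  have symB': "B $$ (i,j) = B $$ (j,i)" if "i < ?N" "j < ?N" for i j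
    using that B symB by (metis index_transpose_mat(1) carrier_matD)
  \<comment> \<open>The entry pairs column \<open>i\<close> of \<open>P\<close> with
    \<open>A\<close> times column 0, an eigenvector, which gives \<open>e\<close> times an entry of
    \<open>P\<^sup>T * P\<close>.\<close>
  have Bi0: "B $$ (i,0) = (if i = 0 then e else 0)" if i: "i < ?N" for i
  proof -
    have Av: "A *\<^sub>v col P 0 = e \<cdot>\<^sub>v col P 0"
      unfolding P(3) using A v by (simp add: mult_mat_vec smult_smult_assoc mult.commute)
    have "B = P\<^sup>T * (A * P)" unfolding B_def using P A by (simp add: mult_mat_assoc)
    hence "B $$ (i,0) = col P i \<bullet> col (A * P) 0"
      using i P A by simp
    also have "col (A * P) 0 = A *\<^sub>v col P 0"
      using A P by (intro col_mult2[of _ ?N ?N _ ?N]) auto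
    also have "col P i \<bullet> (A *\<^sub>v col P 0) = e * (P\<^sup>T * P) $$ (i,0)"
      unfolding Av using i P(1) by simp
    finally show ?thesis unfolding P(2) using i by simp
  qed
  define B' where "B' = Matrix.mat n n (\<lambda>(i,j). B $$ (Suc i, Suc j))"
  have B': "B' \<in> carrier_mat n n" unfolding B'_def by simp
  have "B'\<^sup>T = B'" by (rule eq_matI) (auto simp: B'_def symB')
  from Suc.IH[OF B' this] obtain Q d where
    Q: "Q \<in> carrier_mat n n" "Q\<^sup>T * Q = 1\<^sub>m n" "B' = Q * mat_diag n d * Q\<^sup>T" by blast
  let ?Z1 = "0\<^sub>m 1 n :: real mat" and ?Z2 = "0\<^sub>m n 1 :: real mat" and ?I = "1\<^sub>m 1 :: real mat"
  \<comment> \<open>\<open>F\<close> extends the orthogonal matrix of the smaller block by a 1 in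
    the corner, and \<open>d'\<close> puts \<open>e\<close> in front of the eigenvalues
    \<open>d\<close>.\<close>
  define F where "F = four_block_mat ?I ?Z1 ?Z2 Q"
  define d' where "d' i = (case i of 0 \<Rightarrow> e | Suc j \<Rightarrow> d j)" for i
  have F: "F \<in> carrier_mat ?N ?N" unfolding F_def using Q by auto
  have FT: "F\<^sup>T = four_block_mat ?I ?Z1 ?Z2 Q\<^sup>T"
    unfolding F_def using Q by (subst transpose_four_block_mat) auto
  have FF: "F\<^sup>T * F = 1\<^sub>m ?N"
    unfolding FT unfolding F_def using Q
    by (subst mult_four_block_mat[of _ 1 1 _ n _ n _ _ 1 _ n]) auto
  have D: "mat_diag ?N d' = four_block_mat (e \<cdot>\<^sub>m ?I) ?Z1 ?Z2 (mat_diag n d)"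
    by (rule eq_matI) (auto simp: mat_diag_def d'_def split: nat.splits)
  have "B = four_block_mat (e \<cdot>\<^sub>m ?I) ?Z1 ?Z2 B'"
  proof (rule eq_matI)
    fix i j assume "i < dim_row (four_block_mat (e \<cdot>\<^sub>m ?I) ?Z1 ?Z2 B')"
      "j < dim_col (four_block_mat (e \<cdot>\<^sub>m ?I) ?Z1 ?Z2 B')"
    hence ij: "i < ?N" "j < ?N" using B' by auto
    show "B $$ (i,j) = four_block_mat (e \<cdot>\<^sub>m ?I) ?Z1 ?Z2 B' $$ (i,j)"
      using ij Bi0[OF ij(1)] Bi0[OF ij(2)] symB'[OF ij]
      by (cases i; cases j) (auto simp: B'_def)
  qed (use B B' in auto)
  also have "\<dots> = F * mat_diag ?N d' * F\<^sup>T"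
    unfolding FT D unfolding F_def
    using Q(1) left_add_zero_mat[OF B'] unfolding Q(3)
    by (simp add: mult_four_block_mat[of _ 1 1 _ n _ n _ _ 1 _ n])
  finally have BF: "B = F * mat_diag ?N d' * F\<^sup>T" .
  \<comment> \<open>The change of basis is undone; the matrix diagonalizing \<open>A\<close> is then
    \<open>P * F\<close>.\<close>
  have "P * B * P\<^sup>T = (P * P\<^sup>T) * A * (P * P\<^sup>T)"
    unfolding B_def using P A by (simp add: mult_mat_assoc)
  hence "A = P * B * P\<^sup>T" using A by (simp add: PP)
  hence "A = (P * F) * mat_diag ?N d' * (P * F)\<^sup>T"
    unfolding BF using P F by (simp add: transpose_mult_mat mult_mat_assoc)
  moreover have "(P * F)\<^sup>T * (P * F) = 1\<^sub>m ?N"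
  proof -
    have "(P * F)\<^sup>T * (P * F) = F\<^sup>T * (P\<^sup>T * P) * F"
      using P(1) F by (simp add: transpose_mult_mat mult_mat_assoc)
    thus ?thesis using F FF P(2) by simp
  qed
  ultimately show ?case using P F by (intro exI[of _ "P * F"] exI[of _ d']) auto
qed

section \<open>Real powers and uniqueness of semi-definite roots\<close>

text \<open>The size of a definite description follows from existence and uniqueness: the first is
  the spectral theorem, the second independence of the diagonalization, since equal eigenvalues have
  equal powers.\<close>

lemma spectral_powr_carrier:
  assumes X: "X \<in> carrier_mat n n" "X\<^sup>T = X"
  shows "spectral_powr X a \<in> carrier_mat n n"
proof -
  obtain Q d where Q: "Q \<in> carrier_mat n n" "Q\<^sup>T * Q = 1\<^sub>m n" "X = Q * mat_diag n d * Q\<^sup>T"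
    using real_spectral_theorem[OF X] by blast
  have "spectral_powr X a = Q * mat_diag n (\<lambda>i. d i powr a) * Q\<^sup>T"
    unfolding spectral_powr_def Let_def
  proof (rule the_equality)
    show "\<exists>P e. P \<in> carrier_mat (dim_row X) (dim_row X) \<and> P\<^sup>T * P = 1\<^sub>m (dim_row X) \<and>
        X = P * mat_diag (dim_row X) e * P\<^sup>T \<and>
        Q * mat_diag n (\<lambda>i. d i powr a) * Q\<^sup>T = P * mat_diag (dim_row X) (\<lambda>i. e i powr a) * P\<^sup>T"
      using Q X(1) by (intro exI[of _ Q] exI[of _ d]) auto
  next
    fix Y
    assume "\<exists>P e. P \<in> carrier_mat (dim_row X) (dim_row X) \<and> P\<^sup>T * P = 1\<^sub>m (dim_row X) \<and>
        X = P * mat_diag (dim_row X) e * P\<^sup>T \<and>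
        Y = P * mat_diag (dim_row X) (\<lambda>i. e i powr a) * P\<^sup>T"
    then obtain P e where P: "P \<in> carrier_mat n n" "P\<^sup>T * P = 1\<^sub>m n" "X = P * mat_diag n e * P\<^sup>T"
      "Y = P * mat_diag n (\<lambda>i. e i powr a) * P\<^sup>T" using X(1) by auto
    show "Y = Q * mat_diag n (\<lambda>i. d i powr a) * Q\<^sup>T"
      unfolding P(4)
      by (rule diagonalization_independence[OF P(1,2) Q(1,2) P(3)[symmetric, unfolded Q(3)]]) auto
  qed
  thus ?thesis using Q by auto
qed

text \<open>The quadratic form at column \<open>i\<close> of \<open>Q\<close> evaluates to
  \<open>d i\<close>, because \<open>Q\<^sup>T\<close> sends this column to the \<open>i\<close>-th
  unit vector.\<close>

lemma psd_mat_diagonalization: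
  assumes A: "A \<in> carrier_mat n n" and psd: "psd_mat A"
  obtains Q d where "Q \<in> carrier_mat n n" "Q\<^sup>T * Q = 1\<^sub>m n" "A = Q * mat_diag n d * Q\<^sup>T"
    "\<And>i. i < n \<Longrightarrow> 0 \<le> d i"
proof -
  have "A\<^sup>T = A" using psd unfolding psd_mat_def by simp
  then obtain Q d where Q: "Q \<in> carrier_mat n n" "Q\<^sup>T * Q = 1\<^sub>m n" "A = Q * mat_diag n d * Q\<^sup>T"
    using real_spectral_theorem[OF A] by blast
  have "0 \<le> d i" if i: "i < n" for i
  proof -
    have c: "col Q i \<in> carrier_vec n" using Q i by auto
    have "0 \<le> col Q i \<bullet> (A *\<^sub>v col Q i)" using psd c A unfolding psd_mat_def by auto
    also have "\<dots> = (\<Sum>j<n. d j * ((Q\<^sup>T *\<^sub>v col Q i) $ j)\<^sup>2)"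
      unfolding Q(3) by (rule quadratic_form_sandwich[OF Q(1) c])
    also have "\<dots> = (\<Sum>j<n. if j = i then d j else 0)"
    proof (rule sum.cong)
      fix j assume "j \<in> {..<n}"
      hence j: "j < n" by simp
      have "(Q\<^sup>T *\<^sub>v col Q i) $ j = (Q\<^sup>T * Q) $$ (j,i)" using i j Q(1) by simp
      thus "d j * ((Q\<^sup>T *\<^sub>v col Q i) $ j)\<^sup>2 = (if j = i then d j else 0)"
        unfolding Q(2) using i j by simp
    qed simp
    also have "\<dots> = d i" using i by simp
    finally show ?thesis .
  qed
  with Q that show ?thesis by blast
qed

text \<open>Equal powers give two diagonalizations of one matrix, with eigenvalues
  \<open>d i ^ k\<close> and \<open>e i ^ k\<close>. Taking powers is injective on nonnegative
  reals, so independence of the diagonalization leads back to \<open>d\<close> and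
  \<open>e\<close>.\<close>

lemma psd_root_unique:
  assumes k: "k > 0" and Y: "psd_mat Y" and Z: "psd_mat Z" and eq: "Y ^\<^sub>m k = Z ^\<^sub>m k"
  shows "Y = Z"
proof -
  define n where "n = dim_row Y"
  have Yc: "Y \<in> carrier_mat n n" using Y unfolding psd_mat_def n_def by auto
  \<comment> \<open>A power has the dimensions of its base, which carries the size of
    \<open>Y\<close> over to \<open>Z\<close>.\<close>
  have "dim_row Z = n" using arg_cong[OF eq, of dim_row] unfolding n_def by simp
  hence Zc: "Z \<in> carrier_mat n n" using Z unfolding psd_mat_def by auto
  obtain Q d where Q: "Q \<in> carrier_mat n n" "Q\<^sup>T * Q = 1\<^sub>m n" "Y = Q * mat_diag n d * Q\<^sup>T"
    "\<And>i. i < n \<Longrightarrow> 0 \<le> d i" using psd_mat_diagonalization[OF Yc Y] by blast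
  obtain P e where P: "P \<in> carrier_mat n n" "P\<^sup>T * P = 1\<^sub>m n" "Z = P * mat_diag n e * P\<^sup>T"
    "\<And>i. i < n \<Longrightarrow> 0 \<le> e i" using psd_mat_diagonalization[OF Zc Z] by blast
  obtain j where j: "k = Suc j" using k by (cases k) auto
  have "Q * mat_diag n (\<lambda>i. d i ^ k) * Q\<^sup>T = P * mat_diag n (\<lambda>i. e i ^ k) * P\<^sup>T"
    using eq unfolding j Q(3) P(3) sandwich_pow[OF Q(1,2)] sandwich_pow[OF P(1,2)] .
  thus ?thesis
    unfolding Q(3) P(3)
    by (rule diagonalization_independence[OF Q(1,2) P(1,2)])
      (use k Q(4) P(4) power_eq_imp_eq_base in blast)
qed

lemma psd_root_eqI:
  assumes "k > 0" "psd_mat Y" "Y ^\<^sub>m k = X"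
  shows "psd_root k X = Y"
  unfolding psd_root_def
proof (rule the_equality)
  show "psd_mat Y \<and> Y ^\<^sub>m k = X" using assms by simp
  show "Z = Y" if "psd_mat Z \<and> Z ^\<^sub>m k = X" for Z
    using that assms psd_root_unique[of k Z Y] by simp
qed

section \<open>Fourth roots of Gram matrices and the Muon direction\<close>

text \<open>\<open>M * M\<^sup>T\<close> has the squares \<open>s i * s i\<close> in the middle, so
  its fourth root has \<open>sqrt (s i)\<close> there. Exchanging \<open>U\<close> and
  \<open>V\<close> covers \<open>M\<^sup>T * M\<close>.\<close>

lemma psd_root_4_gram:
  fixes U V :: "real mat"
  assumes U: "U \<in> carrier_mat m k" "U\<^sup>T * U = 1\<^sub>m k"
    and V: "V \<in> carrier_mat n k" "V\<^sup>T * V = 1\<^sub>m k"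
    and s: "\<And>i. i < k \<Longrightarrow> 0 \<le> s i"
    and M: "M = U * mat_diag k s * V\<^sup>T"
  shows "psd_root 4 (M * M\<^sup>T) = U * mat_diag k (\<lambda>i. sqrt (s i)) * U\<^sup>T"
proof (rule psd_root_eqI)
  show "psd_mat (U * mat_diag k (\<lambda>i. sqrt (s i)) * U\<^sup>T)"
    using U s by (intro psd_mat_sandwich) auto
  have "(U * mat_diag k (\<lambda>i. sqrt (s i)) * U\<^sup>T) ^\<^sub>m 4 = U * mat_diag k (\<lambda>i. sqrt (s i) ^ 4) * U\<^sup>T"
    using sandwich_pow[OF U, of _ 3] by (simp add: eval_nat_numeral)
  \<comment> \<open>Nonnegativity of \<open>s\<close> is known only below \<open>k\<close>, so the
    matrices are compared rather than the functions.\<close>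
  also have "mat_diag k (\<lambda>i. sqrt (s i) ^ 4) = mat_diag k (\<lambda>i. s i * s i)"
  proof -
    have "sqrt (s i) ^ 4 = s i * s i" if "i < k" for i
    proof -
      have "sqrt (s i) ^ 4 = ((sqrt (s i))\<^sup>2)\<^sup>2" by (simp only: power_mult[symmetric]) simp
      thus ?thesis unfolding real_sqrt_pow2[OF s[OF that]] by (simp add: power2_eq_square)
    qed
    thus ?thesis unfolding mat_diag_def by (intro eq_matI) auto
  qed
  also have "U * mat_diag k (\<lambda>i. s i * s i) * U\<^sup>T = M * M\<^sup>T"
    unfolding M transpose_sandwich[OF U(1) V(1)] by (simp add: sandwich_mult[OF U(1) V(1) U(1) V(2)])
  finally show "(U * mat_diag k (\<lambda>i. sqrt (s i)) * U\<^sup>T) ^\<^sub>m 4 = M * M\<^sup>T" .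
qed simp

text \<open>Each root carries \<open>sqrt (s i)\<close> in the middle, and together they restore the
  singular values. The sizes are recorded because \<open>psd_root\<close> is a definite
  description.\<close>

lemma muon_factorization:
  assumes M: "M \<in> carrier_mat m n" and svd: "reduced_svd M U S V"
  defines "Y \<equiv> psd_root 4 (M * M\<^sup>T)" and "Z \<equiv> psd_root 4 (M\<^sup>T * M)"
  shows "Y \<in> carrier_mat m m" "Z \<in> carrier_mat n n" "U * V\<^sup>T \<in> carrier_mat m n"
    "Y * (U * V\<^sup>T) * Z = M"
proof -
  define k where "k = vec_space.rank m M"
  define s where "s i = S $$ (i,i)" for i
  from svd M have U: "U \<in> carrier_mat m k" "U\<^sup>T * U = 1\<^sub>m k"
    and V: "V \<in> carrier_mat n k" "V\<^sup>T * V = 1\<^sub>m k"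
    and S: "S \<in> carrier_mat k k" "diagonal_mat S" and pos: "\<And>i. i < k \<Longrightarrow> 0 < s i"
    and MS: "M = U * S * V\<^sup>T"
    unfolding reduced_svd_def Let_def k_def s_def by auto
  have "S = mat_diag k s"
    using S unfolding mat_diag_def s_def diagonal_mat_def by (intro eq_matI) auto
  hence M_eq: "M = U * mat_diag k s * V\<^sup>T" using MS by simp
  have MT_eq: "M\<^sup>T = V * mat_diag k s * U\<^sup>T"
    unfolding M_eq by (rule transpose_sandwich[OF U(1) V(1)])
  have s0: "0 \<le> s i" if "i < k" for i using pos[OF that] by simp
  have Y: "Y = U * mat_diag k (\<lambda>i. sqrt (s i)) * U\<^sup>T"
    unfolding Y_def by (rule psd_root_4_gram[OF U V s0 M_eq])
  have Z: "Z = V * mat_diag k (\<lambda>i. sqrt (s i)) * V\<^sup>T"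
    unfolding Z_def using psd_root_4_gram[OF V U s0 MT_eq] by simp
  show "Y \<in> carrier_mat m m" "Z \<in> carrier_mat n n" "U * V\<^sup>T \<in> carrier_mat m n"
    using U V unfolding Y Z by auto
  \<comment> \<open>An identity in the middle gives the Muon direction the sandwich shape;
    \<open>mat_diag_one\<close> would simplify it away again.\<close>
  have UV: "U * V\<^sup>T = U * mat_diag k (\<lambda>i. 1) * V\<^sup>T" using U by simp
  have "Y * (U * V\<^sup>T) * Z = U * mat_diag k (\<lambda>i. sqrt (s i) * sqrt (s i)) * V\<^sup>T"
    unfolding Y Z UV by (simp add: sandwich_mult[OF U(1) U(1) V(1) U(2)] sandwich_mult[OF U(1) V(1) V(1) V(2)]
        del: mat_diag_one)
  also have "mat_diag k (\<lambda>i. sqrt (s i) * sqrt (s i)) = mat_diag k s"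
    unfolding mat_diag_def using s0 by (intro eq_matI) auto
  finally show "Y * (U * V\<^sup>T) * Z = M" using M_eq by simp
qed

section \<open>Exponential moving averages and the final factorization\<close>

lemma ema_carrier:
  assumes "\<And>s. 1 \<le> s \<Longrightarrow> X s \<in> carrier_mat r c"
  shows "ema r c \<beta> X t \<in> carrier_mat r c"
  using assms by (induction t) auto

text \<open>Symmetry is preserved by linear combinations. It makes the spectral theorem available
  for the Shampoo factors.\<close>

lemma ema_symmetric:
  assumes "\<And>s. 1 \<le> s \<Longrightarrow> X s \<in> carrier_mat r r" "\<And>s. 1 \<le> s \<Longrightarrow> (X s)\<^sup>T = X s"
  shows "(ema r r \<beta> X t)\<^sup>T = ema r r \<beta> X t"
proof (induction t)
  case (Suc t)
  have "ema r r \<beta> X t \<in> carrier_mat r r" "X (Suc t) \<in> carrier_mat r r"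
    using assms(1) by (auto intro: ema_carrier)
  moreover have "(c \<cdot>\<^sub>m Y)\<^sup>T = c \<cdot>\<^sub>m Y\<^sup>T" for c and Y :: "real mat"
    by (rule eq_matI) auto
  ultimately show ?case
    using Suc assms(2)[of "Suc t"] by (simp add: transpose_add[of _ r r])
qed simp

theorem mainTheorem1:
  fixes m n t :: nat and p \<beta>1 \<beta>2 :: real
    and G :: "nat \<Rightarrow> real mat" and M L R U S V :: "real mat"
  assumes "0 < p"
    and "0 \<le> \<beta>1" "\<beta>1 < 1" "0 \<le> \<beta>2" "\<beta>2 < 1"
    and "\<And>s. 1 \<le> s \<Longrightarrow> G s \<in> carrier_mat m n"
    and "M = momentum m n \<beta>1 G t"
    and "L = shampoo_L m \<beta>2 G t"
    and "R = shampoo_R n \<beta>2 G t"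
    and "reduced_svd M U S V"
    and "invertible_mat L" "invertible_mat R"
  shows "spectral_powr L (-p) * M * spectral_powr R (-p) =
    (spectral_powr L (-p) * psd_root 4 (M * transpose_mat M))
      * (U * transpose_mat V)
      * (psd_root 4 (transpose_mat M * M) * spectral_powr R (-p))"
proof -
  note G = assms(6)
  have GT: "(G s)\<^sup>T \<in> carrier_mat n m" if "1 \<le> s" for s using G[OF that] by simp
  have M: "M \<in> carrier_mat m n"
    unfolding assms(7) momentum_def using G by (rule ema_carrier)
  have L: "L \<in> carrier_mat m m" "L\<^sup>T = L"
    unfolding assms(8) shampoo_L_def using mult_carrier_mat[OF G GT] transpose_mult[OF G GT]
    by (auto intro!: ema_carrier ema_symmetric)
  have R: "R \<in> carrier_mat n n" "R\<^sup>T = R"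
    unfolding assms(9) shampoo_R_def using mult_carrier_mat[OF GT G] transpose_mult[OF GT G]
    by (auto intro!: ema_carrier ema_symmetric)
  define A where "A = spectral_powr L (-p)"
  define B where "B = spectral_powr R (-p)"
  define Y where "Y = psd_root 4 (M * M\<^sup>T)"
  define Z where "Z = psd_root 4 (M\<^sup>T * M)"
  define W where "W = U * V\<^sup>T"
  have A: "A \<in> carrier_mat m m" and B: "B \<in> carrier_mat n n"
    unfolding A_def B_def using spectral_powr_carrier L R by blast+
  note YWZ = muon_factorization[OF M assms(10), folded Y_def Z_def W_def]
  \<comment> \<open>Only the middle factor is rewritten; the rest is rebracketing, which needs the
    sizes of all five factors.\<close>
  have "A * M * B = A * (Y * W * Z) * B" by (simp only: YWZ(4))
  also have "\<dots> = (A * Y) * W * (Z * B)"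
    using A B YWZ(1-3)
    by (simp add: mult_mat_assoc)
  finally show ?thesis
    unfolding A_def B_def Y_def Z_def W_def .
qed

end
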